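(* Let $r,d$ be fixed integers with $r\ge d+1\ge 3$. Then $$\mathrm{ex}_{\to}(n,\mathrm{ord}(\mathcal{S}_d^r))=\Theta(n^{r-1})\qquad (n\to\infty),$$ i.e. there are constants $c,C>0$ and $n_0$, depending only on $r$ and $d$, such that $c\,n^{r-1}\le \mathrm{ex}_{\to}(n,\mathrm{ord}(\mathcal{S}_d^r))\le C\,n^{r-1}$ for all $n\ge n_0$. Here $\mathcal{S}_d^r$ is the family of all $d$-dimensional $r$-simplices.
   Context: An $r$-graph is a finite hypergraph all of whose edges have size $r$; hypergraphs are identified with their edge sets. An ordered $r$-graph is an $r$-graph with a linear ordering of its vertex set. An ordered $r$-graph is interval $r$-partite if there are intervals (sets of consecutive vertices) $I_1<I_2<\dots<I_r$ in the vertex ordering such that every edge has exactly one vertex in each $I_j$ (where $A<B$ means that every element of $A$ precedes every element of $B$). For an $r$-graph $F$, $\mathrm{ord}(F)$ is the family of interval $r$-partite ordered $r$-graphs that are isomorphic to $F$ as unordered $r$-graphs (this is empty if $F$ is not $r$-partite). For a family $\mathcal F$ of $r$-graphs, $\mathrm{ord}(\mathcal F)=\bigcup_{F\in\mathcal F}\mathrm{ord}(F)$. An ordered $r$-graph $H$ contains an ordered $r$-graph $F$ if there is an order-preserving injection $V(F)\to V(H)$ mapping edges to edges. For a family $\mathcal G$ of ordered $r$-graphs, $\mathrm{ex}_{\to}(n,\mathcal G)$ is the maximum number of edges in an $n$-vertex ordered $r$-graph that contains no member of $\mathcal G$. A $d$-dimensional $r$-simplex is an $r$-graph with $d+1$ edges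 such that any $d$ of the edges have nonempty intersection, but all $d+1$ edges have empty intersection. *)

theory Defs
  imports Complex_Main "HOL-Library.Landau_Symbols"
begin

text \<open>
  A hypergraph is a pair of a vertex set and an edge set. An ordered hypergraph is a hypergraph
  whose vertices come from a linearly ordered type, its vertex set carrying the induced order.
  Families of hypergraphs and host hypergraphs use vertices in \<^typ>\<open>nat\<close>: every finite
  linearly ordered set is order-isomorphic to a finite set of natural numbers.
\<close>

type_synonym 'a hypergraph = "'a set \<times> 'a set set"

abbreviation verts :: "'a hypergraph \<Rightarrow> 'a set" where
  "verts H \<equiv> fst H"

abbreviation edges :: "'a hypergraph \<Rightarrow> 'a set set" where
  "edges H \<equiv> snd H"

definition r_graph :: "nat \<Rightarrow> 'a hypergraph \<Rightarrow> bool" where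
  "r_graph r H \<longleftrightarrow>
     finite (verts H) \<and> (\<forall>e\<in>edges H. e \<subseteq> verts H \<and> card e = r)"

definition isomorphic :: "'a hypergraph \<Rightarrow> 'b hypergraph \<Rightarrow> bool" where
  "isomorphic F G \<longleftrightarrow>
     (\<exists>f. bij_betw f (verts F) (verts G) \<and> (\<lambda>e. f ` e) ` edges F = edges G)"

definition interval_in :: "'a::linorder set \<Rightarrow> 'a set \<Rightarrow> bool" where
  "interval_in V I \<longleftrightarrow>
     I \<subseteq> V \<and> (\<forall>x\<in>I. \<forall>y\<in>I. \<forall>z\<in>V. x \<le> z \<and> z \<le> y \<longrightarrow> z \<in> I)"

definition interval_partite :: "nat \<Rightarrow> 'a::linorder hypergraph \<Rightarrow> bool" where
  "interval_partite r H \<longleftrightarrow>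
     (\<exists>I. (\<forall>j\<in>{1..r}. interval_in (verts H) (I j)) \<and>
          (\<forall>i\<in>{1..r}. \<forall>j\<in>{1..r}. i < j \<longrightarrow> (\<forall>x\<in>I i. \<forall>y\<in>I j. x < y)) \<and>
          (\<forall>e\<in>edges H. \<forall>j\<in>{1..r}. card (e \<inter> I j) = 1))"

definition ord_graph :: "nat \<Rightarrow> nat hypergraph \<Rightarrow> nat hypergraph set" where
  "ord_graph r F = {G. r_graph r G \<and> interval_partite r G \<and> isomorphic F G}"

definition ord_family :: "nat \<Rightarrow> nat hypergraph set \<Rightarrow> nat hypergraph set" where
  "ord_family r \<F> = (\<Union>F\<in>\<F>. ord_graph r F)"

definition ord_contains :: "'a::linorder hypergraph \<Rightarrow> 'b::linorder hypergraph \<Rightarrow> bool" where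
  "ord_contains H F \<longleftrightarrow>
     (\<exists>f. strict_mono_on (verts F) f \<and> f ` verts F \<subseteq> verts H \<and>
          (\<forall>e\<in>edges F. f ` e \<in> edges H))"

definition ex_ord :: "nat \<Rightarrow> nat \<Rightarrow> nat hypergraph set \<Rightarrow> nat" where
  "ex_ord r n \<G> =
     Max {card (edges H) | H :: nat hypergraph.
            r_graph r H \<and> card (verts H) = n \<and> (\<forall>G\<in>\<G>. \<not> ord_contains H G)}"

definition simplices :: "nat \<Rightarrow> nat \<Rightarrow> nat hypergraph set" where
  "simplices d r =
     {F. r_graph r F \<and> card (edges F) = d + 1 \<and>
         (\<forall>A. A \<subseteq> edges F \<and> card A = d \<longrightarrow> \<Inter>A \<noteq> {}) \<and>
         \<Inter>(edges F) = {}}"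

end

theory Submission
  imports Defs
begin

text \<open>
  Lower bound: all \<open>r\<close>-sets through one fixed vertex contain no simplex.

  Upper bound: call a vertex \<open>a\<close> of an edge \<open>e\<close> raisable if replacing \<open>a\<close> by some larger vertex,
  still below the next vertex of \<open>e\<close>, gives another edge. A pair of an edge and a non-raisable
  vertex is determined by the remaining \<open>r - 1\<close> vertices and the position of the missing one, so
  deleting every edge with a non-raisable vertex costs only \<open>O(n^(r-1))\<close> edges. If an edge \<open>x\<close>
  survives \<open>r\<close> rounds of deletion, then any set of vertices of \<open>x\<close> can be raised simultaneously,
  by treating them in increasing order. Partition \<open>x\<close> into \<open>d + 1\<close> nonempty parts; the edges
  obtained from \<open>x\<close> by raising one part each form a simplex, and the vertices of \<open>x\<close> are the left
  ends of intervals that make it interval \<open>r\<close>-partite.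
\<close>

text \<open>Also meant for \<open>v\<close> outside \<open>x\<close>: it then numbers the gap of
  \<open>x\<close> in which \<open>v\<close> lies, with 0 for the gap below all of
  \<open>x\<close>.\<close>

definition rank_in :: "'a::linorder set \<Rightarrow> 'a \<Rightarrow> nat" where
  "rank_in x v = card {c \<in> x. c \<le> v}"

definition raisable :: "'a::linorder set set \<Rightarrow> 'a set \<Rightarrow> 'a \<Rightarrow> bool" where
  "raisable E e a \<longleftrightarrow> (\<exists>b. a < b \<and> (\<forall>c\<in>e. a < c \<longrightarrow> b < c) \<and> insert b (e - {a}) \<in> E)"

text \<open>The replacement edge lies in \<open>E\<close> but perhaps not in the core. Hence the
  core is iterated: each raising of a vertex costs one round.\<close>

definition raisable_core :: "'a::linorder set set \<Rightarrow> 'a set set" where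
  "raisable_core E = {e \<in> E. \<forall>a\<in>e. raisable E e a}"

text \<open>The upper bound on \<open>g a\<close> refers to the original \<open>x\<close>, so
  \<open>g a\<close> stays in the half-open interval from \<open>a\<close> to its successor in
  \<open>x\<close>, whatever \<open>A\<close> is.\<close>

definition raises :: "'a::linorder set \<Rightarrow> 'a set \<Rightarrow> ('a \<Rightarrow> 'a) \<Rightarrow> bool" where
  "raises x A g \<longleftrightarrow>
     (\<forall>a\<in>x. (a \<in> A \<longrightarrow> a < g a) \<and> (a \<notin> A \<longrightarrow> g a = a) \<and> (\<forall>c\<in>x. a < c \<longrightarrow> g a < c))"

section \<open>Ranks relative to a fixed edge\<close>

lemma rank_in_mono: "finite x \<Longrightarrow> u \<le> v \<Longrightarrow> rank_in x u \<le> rank_in x v"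
  unfolding rank_in_def by (intro card_mono) auto

lemma bij_betw_rank_in:
  assumes "finite x"
  shows "bij_betw (rank_in x) x {1..card x}"
proof -
  have inj: "inj_on (rank_in x) x"
  proof (rule linorder_inj_onI)
    fix a b assume "a < b" "a \<in> x" "b \<in> x"
    then have "{c \<in> x. c \<le> a} \<subset> {c \<in> x. c \<le> b}" by force
    then have "rank_in x a < rank_in x b"
      unfolding rank_in_def using assms by (intro psubset_card_mono) auto
    then show "rank_in x a \<noteq> rank_in x b" by simp
  qed auto
  have "rank_in x a \<in> {1..card x}" if "a \<in> x" for a
  proof -
    have "card {c \<in> x. c \<le> a} \<noteq> 0" using that assms by auto
    moreover have "card {c \<in> x. c \<le> a} \<le> card x" using assms by (intro card_mono) auto
    ultimately show ?thesis by (simp add: rank_in_def)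
  qed
  then have "rank_in x ` x \<subseteq> {1..card x}" by blast
  moreover have "card (rank_in x ` x) = card {1..card x}" using inj by (simp add: card_image)
  ultimately show ?thesis
    using inj by (simp add: bij_betw_def card_subset_eq)
qed

lemma rank_in_raises:
  assumes "raises x A g" "a \<in> x"
  shows "rank_in x (g a) = rank_in x a"
proof -
  have "a \<le> g a"
    using assms unfolding raises_def by (metis less_imp_le order_refl)
  moreover have "\<forall>c\<in>x. a < c \<longrightarrow> g a < c"
    using assms unfolding raises_def by blast
  ultimately have "{c \<in> x. c \<le> g a} = {c \<in> x. c \<le> a}"
    by (meson leD leI order_trans)
  then show ?thesis by (simp add: rank_in_def)
qed

text \<open>Raising preserves ranks and ranks separate the vertices of \<open>x\<close>, so a raised
  vertex remembers its origin, even across different raisings.\<close>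

lemma raises_eqD:
  assumes "finite x" "raises x A g" "raises x B h" "a \<in> x" "b \<in> x" "g a = h b"
  shows "a = b"
  using rank_in_raises[OF assms(2,4)] rank_in_raises[OF assms(3,5)] assms(4-6)
    bij_betw_rank_in[OF assms(1)]
  by (metis bij_betw_def inj_onD)

section \<open>Deleting edges with a non-raisable vertex\<close>

lemma card_diff_raisable_core:
  fixes E :: "'a::linorder set set"
  assumes "finite V" and E: "\<And>e. e \<in> E \<Longrightarrow> e \<subseteq> V \<and> card e = r"
  shows "card (E - raisable_core E) \<le> r * (card V choose (r - 1))"
proof -
  define B where "B = {(e, a). e \<in> E \<and> a \<in> e \<and> \<not> raisable E e a}"
  \<comment> \<open>The rank of \<open>a\<close> in \<open>e - {a}\<close> is the index of its gap.
    There are \<open>r\<close> gaps around \<open>r - 1\<close> vertices, whence the factor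
    \<open>{..<r}\<close> in \<open>T\<close>.\<close>
  define f where "f = (\<lambda>(e :: 'a set, a). (e - {a}, rank_in (e - {a}) a))"
  define T where "T = {s. s \<subseteq> V \<and> card s = r - 1} \<times> {..<r}"
  have fin: "finite e" if "e \<in> E" for e
    using E[OF that] assms(1) finite_subset by blast
  \<comment> \<open>Equal codes place \<open>a\<close> and \<open>a'\<close> in the same gap of the
    same set of \<open>r - 1\<close> vertices. So \<open>a'\<close> may replace \<open>a\<close> in
    \<open>e\<close>, giving \<open>e' \<in> E\<close>, and \<open>a\<close> was raisable after
    all.\<close>
  have key: False if "(e, a) \<in> B" "(e', a') \<in> B" "f (e, a) = f (e', a')" "a < a'" for e e' a a'
  proof -
    have e: "e \<in> E" "a \<in> e" "\<not> raisable E e a" "e' \<in> E" "a' \<in> e'"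
      using that by (auto simp: B_def)
    have s: "e - {a} = e' - {a'}" and "rank_in (e - {a}) a = rank_in (e' - {a'}) a'"
      using that(3) unfolding f_def case_prod_conv prod.inject by blast+
    then have rk: "rank_in (e - {a}) a = rank_in (e - {a}) a'" by argo
    have "{c \<in> e - {a}. c \<le> a} = {c \<in> e - {a}. c \<le> a'}"
      using rk fin[OF e(1)] \<open>a < a'\<close> unfolding rank_in_def
      by (intro card_subset_eq) auto
    then have "c \<le> a \<longleftrightarrow> c \<le> a'" if "c \<in> e - {a}" for c using that by blast
    then have "\<forall>c\<in>e. a < c \<longrightarrow> a' < c"
      by (metis DiffI leD leI less_irrefl singletonD)
    moreover have "insert a' (e - {a}) \<in> E" using s e by (metis insert_Diff)
    ultimately show False using e \<open>a < a'\<close> unfolding raisable_def by blast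
  qed
  have inj: "inj_on f B"
  proof (rule inj_onI)
    fix p q assume pq: "p \<in> B" "q \<in> B" "f p = f q"
    obtain e a e' a' where eq: "p = (e, a)" "q = (e', a')" by (cases p, cases q)
    have "a = a'" using key pq unfolding eq by (metis linorder_cases)
    moreover have "e - {a} = e' - {a'}" "a \<in> e" "a' \<in> e'"
      using pq unfolding eq f_def B_def case_prod_conv prod.inject mem_Collect_eq by blast+
    ultimately show "p = q" unfolding eq by blast
  qed
  have "f ` B \<subseteq> T"
  proof
    fix t assume "t \<in> f ` B"
    then obtain e a where t: "t = f (e, a)" "e \<in> E" "a \<in> e" by (auto simp: B_def)
    have c: "card (e - {a}) = r - 1" "0 < r"
      using t E[of e] fin[of e] by (auto simp: card_gt_0_iff)
    have "rank_in (e - {a}) a \<le> card (e - {a})"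
      unfolding rank_in_def using fin[of e] t by (intro card_mono) auto
    then show "t \<in> T" using c E[of e] t by (auto simp: T_def f_def)
  qed
  moreover have fT: "finite T" using assms(1) by (simp add: T_def)
  ultimately have fB: "finite B" and cB: "card B \<le> card T"
    using inj inj_on_finite[of f B T] card_inj_on_le[of f B T] by simp_all
  have "E - raisable_core E \<subseteq> fst ` B"
    by (force simp: B_def raisable_core_def)
  then have "card (E - raisable_core E) \<le> card B"
    using fB by (meson card_image_le card_mono finite_imageI order_trans)
  also note cB
  also have "card T = r * (card V choose (r - 1))"
    using assms(1) by (simp add: T_def card_cartesian_product n_subsets)
  finally show ?thesis .
qed

lemma raisable_core_iterate_subset: "(raisable_core ^^ k) E \<subseteq> E"
  by (induction k) (auto simp: raisable_core_def)

lemma card_le_raisable_core_iterate: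
  assumes "finite V" and E: "\<And>e. e \<in> E \<Longrightarrow> e \<subseteq> V \<and> card e = r"
  shows "card E \<le> card ((raisable_core ^^ k) E) + k * (r * (card V choose (r - 1)))"
proof (induction k)
  case (Suc k)
  let ?E = "(raisable_core ^^ k) E"
  have "E \<subseteq> Pow V" using E by auto
  then have fin: "finite ?E"
    using assms(1) raisable_core_iterate_subset by (meson finite_Pow_iff finite_subset)
  have "card (?E - raisable_core ?E) \<le> r * (card V choose (r - 1))"
    using raisable_core_iterate_subset E by (intro card_diff_raisable_core assms(1)) blast
  moreover have "card (?E - raisable_core ?E) = card ?E - card (raisable_core ?E)"
    using fin by (intro card_Diff_subset) (auto simp: raisable_core_def elim: finite_subset[rotated])
  ultimately show ?case using Suc by simp
qed simp

text \<open>The induction treats the largest vertex \<open>m\<close> of \<open>A\<close> last. The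
  vertices of \<open>x\<close> above \<open>m\<close> are then still in place, so staying below the
  next vertex of the current edge means staying below the next vertex of \<open>x\<close>. Working
  from the top down could overshoot it.\<close>

lemma raisable_core_iterate_raises:
  assumes "finite A" "A \<subseteq> x" "x \<in> (raisable_core ^^ (k + card A)) E"
  shows "\<exists>g. raises x A g \<and> g ` x \<in> (raisable_core ^^ k) E"
  using assms
proof (induction A arbitrary: k rule: finite_linorder_max_induct)
  case empty
  then show ?case by (intro exI[of _ id]) (auto simp: raises_def)
next
  case (insert m A)
  have "m \<notin> A" using insert.hyps by auto
  then have "x \<in> (raisable_core ^^ (Suc k + card A)) E"
    using insert by simp
  with insert obtain g where g: "raises x A g" "g ` x \<in> (raisable_core ^^ Suc k) E"
    by blast
  have m: "m \<in> x" "g m = m" using insert.prems \<open>m \<notin> A\<close> g by (auto simp: raises_def)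
  then have "m \<in> g ` x" by force
  then obtain b where b: "m < b" "\<forall>c\<in>g ` x. m < c \<longrightarrow> b < c"
      "insert b (g ` x - {m}) \<in> (raisable_core ^^ k) E"
    using g(2) by (auto simp: raisable_core_def raisable_def)
  have above: "g c = c" if "c \<in> x" "m < c" for c
    using that g insert.hyps by (force simp: raises_def)
  \<comment> \<open>Deleting \<open>m\<close> from the current edge thus removes the image of no
    other vertex of \<open>x\<close>.\<close>
  have other: "g c \<noteq> m" if "c \<in> x" "c \<noteq> m" for c
    using that g m above by (metis less_irrefl linorder_neqE raises_def)
  have "raises x (insert m A) (g(m := b))"
    unfolding raises_def
  proof (intro ballI conjI impI)
    fix a c assume ac: "a \<in> x" "c \<in> x" "a < c"
    show "(g(m := b)) a < c"
    proof (cases "a = m")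
      case True
      then have "c \<in> g ` x" using above ac by (metis imageI)
      then show ?thesis using b(2) ac True by (simp del: ball_simps)
    next
      case False
      then show ?thesis using g(1) ac by (simp add: raises_def)
    qed
  qed (use g(1) b(1) in \<open>auto simp: raises_def\<close>)
  moreover have "(g(m := b)) ` x = insert b (g ` x - {m})"
    using m other by (auto simp: image_iff)
  ultimately show ?case using b by metis
qed

section \<open>Interval partite simplices from raised edges\<close>

lemma interval_partite_raises:
  assumes "finite x" and F: "\<And>e. e \<in> F \<Longrightarrow> \<exists>A g. raises x A g \<and> e = g ` x"
  shows "interval_partite (card x) (V \<union> \<Union>F, F)"
proof -
  \<comment> \<open>For \<open>j \<ge> 1\<close> these are the vertices from the \<open>j\<close>-th
    vertex of \<open>x\<close> up to just before the next one. Raising preserves ranks, so a raised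
    edge meets \<open>I j\<close> only in the image of that \<open>j\<close>-th vertex.\<close>
  define I where "I j = {v \<in> V \<union> \<Union>F. rank_in x v = j}" for j
  have "interval_in (V \<union> \<Union>F) (I j)" for j
    unfolding interval_in_def I_def
    by (smt (verit, best) antisym mem_Collect_eq rank_in_mono[OF assms(1)] subsetI)
  moreover have "u < v" if "i < j" "u \<in> I i" "v \<in> I j" for i j u v
    using that rank_in_mono[OF assms(1), of v u] by (force simp: I_def)
  moreover have "card (e \<inter> I j) = 1" if e: "e \<in> F" and j: "j \<in> {1..card x}" for e j
  proof -
    obtain A g where g: "raises x A g" "e = g ` x" using F[OF e] by blast
    obtain a where a: "a \<in> x" "rank_in x a = j"
      using bij_betw_rank_in[OF assms(1)] j by (metis bij_betw_def imageE)
    have "{b \<in> x. rank_in x b = j} = {a}"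
      using a bij_betw_imp_inj_on[OF bij_betw_rank_in[OF assms(1)]] by (auto dest: inj_onD)
    moreover have "e \<inter> I j = g ` {b \<in> x. rank_in x b = j}"
      using g e rank_in_raises[OF g(1)] by (auto simp: I_def)
    ultimately have "e \<inter> I j = {g a}" by simp
    then show ?thesis by simp
  qed
  ultimately show ?thesis
    unfolding interval_partite_def by (intro exI[of _ I]) auto
qed

text \<open>Edge \<open>j\<close> moves exactly the class \<open>p a = j\<close>. A vertex of class
  \<open>j\<close> therefore lies in every edge but edge \<open>j\<close>, so any \<open>d\<close>
  edges meet. A vertex common to all edges would come from a single \<open>a\<close> in
  \<open>x\<close>, which edge \<open>p a\<close> moves and every other edge fixes.\<close>

lemma raises_simplex:
  fixes x :: "nat set" and p :: "nat \<Rightarrow> nat"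
  assumes "finite x" and p: "p ` x = {..d}" and "d \<ge> 1"
    and g: "\<And>j. j \<le> d \<Longrightarrow> raises x {a \<in> x. p a = j} (g j)"
  defines "F \<equiv> (\<lambda>j. g j ` x) ` {..d}"
  shows "(\<Union>F, F) \<in> simplices d (card x) \<and> interval_partite (card x) (\<Union>F, F)"
proof
  have fixed: "g j a = a" if "j \<le> d" "a \<in> x" "p a \<noteq> j" for j a
    using g[OF that(1)] that by (auto simp: raises_def)
  have moved: "a < g j a" if "j \<le> d" "a \<in> x" "p a = j" for j a
    using g[OF that(1)] that by (auto simp: raises_def)
  have same: "a = b" if "i \<le> d" "j \<le> d" "a \<in> x" "b \<in> x" "g i a = g j b" for i j a b
    using raises_eqD[OF assms(1) g g] that by blast
  have inj: "inj_on (\<lambda>j. g j ` x) {..d}"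
  proof (rule inj_onI, rule ccontr)
    fix i j assume ij: "i \<in> {..d}" "j \<in> {..d}" "g i ` x = g j ` x" "i \<noteq> j"
    obtain a where a: "a \<in> x" "p a = i" using p ij by (metis imageE)
    then obtain b where "b \<in> x" "g i a = g j b" using ij by blast
    then have "g i a = g j a" using same a ij by auto
    then show False using fixed[of j a] moved[of i a] a ij by auto
  qed
  have card_edge: "card (g j ` x) = card x" if "j \<le> d" for j
    using same[OF that that] by (intro card_image inj_onI)
  have "r_graph (card x) (\<Union>F, F)"
    using assms(1) card_edge by (auto simp: r_graph_def F_def)
  moreover have "card F = d + 1" using inj by (simp add: F_def card_image)
  moreover have "\<Inter>A \<noteq> {}" if A: "A \<subseteq> F" "card A = d" for A
  proof -
    have "A \<noteq> F" using A \<open>card F = d + 1\<close> by auto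
    then obtain j where j: "j \<le> d" "g j ` x \<notin> A" using A by (auto simp: F_def)
    obtain a where a: "a \<in> x" "p a = j" using p j by (metis atMost_iff imageE)
    have "a \<in> e" if "e \<in> A" for e
    proof -
      obtain i where i: "i \<le> d" "e = g i ` x" using A \<open>e \<in> A\<close> by (auto simp: F_def)
      then have "g i a = a" using fixed a j \<open>e \<in> A\<close> by blast
      then show ?thesis using i a by force
    qed
    then show ?thesis by blast
  qed
  moreover have "\<Inter>F = {}"
  proof (rule ccontr)
    assume "\<Inter>F \<noteq> {}"
    then obtain v where v: "\<And>j. j \<le> d \<Longrightarrow> v \<in> g j ` x" by (auto simp: F_def)
    obtain a where a: "a \<in> x" "v = g 0 a" using v[of 0] by auto
    have va: "v = g j a" if "j \<le> d" for j
      using v[OF that] a same[of 0 j a] that by auto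
    have "p a \<le> d" using p a by auto
    \<comment> \<open>Since \<open>d \<ge> 1\<close>, there is an edge that fixes
      \<open>a\<close>.\<close>
    obtain j where "j \<le> d" "j \<noteq> p a"
      using \<open>d \<ge> 1\<close> by (metis le0 zero_neq_one)
    then show False
      using va[of "p a"] va[of j] fixed[of j a] moved[of "p a" a] a \<open>p a \<le> d\<close> by auto
  qed
  ultimately show "(\<Union>F, F) \<in> simplices d (card x)" by (simp add: simplices_def)
  show "interval_partite (card x) (\<Union>F, F)"
    using interval_partite_raises[OF assms(1), of F "{}"] g by (auto simp: F_def)
qed

lemma surj_onto_atMost:
  assumes "finite x" "d + 1 \<le> card x"
  shows "\<exists>p :: 'a \<Rightarrow> nat. p ` x = {..d}"
proof -
  obtain h where h: "bij_betw h x {0..<card x}"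
    using ex_bij_betw_finite_nat[OF assms(1)] by blast
  \<comment> \<open>An enumeration truncated at \<open>d\<close>: all surplus elements join class
    \<open>d\<close>.\<close>
  have "(\<lambda>a. min (h a) d) ` x = (\<lambda>k. min k d) ` (h ` x)" by (simp add: image_image)
  also have "\<dots> = {..d}"
  proof -
    have "h ` x = {0..<card x}" using h by (simp add: bij_betw_def)
    moreover have "k \<in> (\<lambda>k. min k d) ` {0..<card x}" if "k \<le> d" for k
      using that assms(2) by (intro image_eqI[of _ _ k]) auto
    ultimately show ?thesis by auto
  qed
  finally show ?thesis by blast
qed

lemma simplex_free_card_le:
  fixes H :: "nat hypergraph"
  assumes "r \<ge> d + 1" "d \<ge> 1" and H: "r_graph r H"
    and free: "\<And>G. G \<in> ord_family r (simplices d r) \<Longrightarrow> \<not> ord_contains H G"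
  shows "card (edges H) \<le> r * (r * (card (verts H) choose (r - 1)))"
proof (rule ccontr)
  assume "\<not> ?thesis"
  moreover have "card (edges H) \<le>
      card ((raisable_core ^^ r) (edges H)) + r * (r * (card (verts H) choose (r - 1)))"
    using H by (intro card_le_raisable_core_iterate) (auto simp: r_graph_def)
  ultimately obtain x where x: "x \<in> (raisable_core ^^ r) (edges H)" by fastforce
  then have "x \<in> edges H" using raisable_core_iterate_subset by blast
  then have fin: "finite x" and card: "card x = r"
    using H by (auto simp: r_graph_def dest: finite_subset)
  obtain p :: "nat \<Rightarrow> nat" where p: "p ` x = {..d}"
    using surj_onto_atMost[OF fin, of d] assms(1) card by metis
  \<comment> \<open>Stated for all \<open>j\<close> to allow a plain choice of \<open>g\<close>; for
    \<open>j > d\<close> the class is empty.\<close>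
  have "\<exists>g. raises x {a \<in> x. p a = j} g \<and> g ` x \<in> edges H" for j
  proof -
    let ?A = "{a \<in> x. p a = j}"
    \<comment> \<open>Raising the class spends one round per vertex, so \<open>r\<close> rounds
      suffice.\<close>
    have "card ?A \<le> r" using fin card card_mono[of x ?A] by auto
    then have "\<exists>g. raises x ?A g \<and> g ` x \<in> (raisable_core ^^ (r - card ?A)) (edges H)"
      using fin x by (intro raisable_core_iterate_raises) auto
    then show ?thesis using raisable_core_iterate_subset by blast
  qed
  then obtain g where g: "\<And>j. raises x {a \<in> x. p a = j} (g j)" "\<And>j. g j ` x \<in> edges H"
    by metis
  define F where "F = (\<lambda>j. g j ` x) ` {..d}"
  have F: "(\<Union>F, F) \<in> simplices d r" "interval_partite r (\<Union>F, F)"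
    using raises_simplex[OF fin p assms(2) g(1)] card by (auto simp: F_def)
  \<comment> \<open>The simplex, with the order of its natural numbers, is its own ordered copy and
    sits in \<open>H\<close> by the identity.\<close>
  have "isomorphic (\<Union>F, F) (\<Union>F, F)"
    unfolding isomorphic_def by (intro exI[of _ id]) auto
  then have "(\<Union>F, F) \<in> ord_family r (simplices d r)"
    using F unfolding ord_family_def ord_graph_def by (auto simp: simplices_def)
  moreover have "ord_contains H (\<Union>F, F)"
    unfolding ord_contains_def
  proof (intro exI[of _ id] conjI)
    have "\<Union>F \<subseteq> verts H" using g(2) H unfolding F_def r_graph_def by blast
    then show "id ` verts (\<Union>F, F) \<subseteq> verts H" by simp
  qed (use g(2) in \<open>auto simp: F_def strict_mono_on_def\<close>)
  ultimately show False using free by blast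
qed

section \<open>Stars contain no simplex\<close>

lemma star_simplex_free:
  fixes H :: "nat hypergraph"
  assumes star: "\<And>e. e \<in> edges H \<Longrightarrow> v \<in> e" and G: "G \<in> ord_family r (simplices d r)"
  shows "\<not> ord_contains H G"
proof
  assume "ord_contains H G"
  then obtain f where f: "strict_mono_on (verts G) f" "\<And>e. e \<in> edges G \<Longrightarrow> f ` e \<in> edges H"
    by (auto simp: ord_contains_def)
  from G obtain F h where F: "F \<in> simplices d r" "r_graph r G"
      "bij_betw h (verts F) (verts G)" "(\<lambda>e. h ` e) ` edges F = edges G"
    by (auto simp: ord_family_def ord_graph_def isomorphic_def)
  have sub: "e \<subseteq> verts F" if "e \<in> edges F" for e
    using F that by (auto simp: simplices_def r_graph_def)
  have inj: "inj_on (f \<circ> h) (verts F)"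
    using F(3) f(1) by (metis bij_betw_def comp_inj_on strict_mono_on_imp_inj_on)
  have v: "\<exists>u\<in>e. f (h u) = v" if "e \<in> edges F" for e
  proof -
    have "h ` e \<in> edges G" using F(4) that by blast
    then show ?thesis using star[OF f(2)] by blast
  qed
  have "card (edges F) = d + 1" "\<Inter>(edges F) = {}" using F by (auto simp: simplices_def)
  then obtain e where e: "e \<in> edges F" by fastforce
  then obtain u where u: "u \<in> e" "f (h u) = v" using v by blast
  \<comment> \<open>Every edge of \<open>F\<close> has a vertex sent to \<open>v\<close>; by
    injectivity it is always \<open>u\<close>, which would lie in all edges.\<close>
  have "u \<in> e'" if "e' \<in> edges F" for e'
    using v[OF that] u sub[OF that] sub[OF e] inj by (auto simp: inj_on_def)
  then show False using \<open>\<Inter>(edges F) = {}\<close> by blast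
qed

text \<open>Infinitely many \<open>H\<close> compete, one family for each vertex set of size
  \<open>n\<close>, but their edge counts are at most \<open>2 ^ n\<close>. This makes
  \<open>Max\<close> meaningful.\<close>

lemma finite_ex_ord_set:
  "finite {card (edges H) | H :: nat hypergraph.
            r_graph r H \<and> card (verts H) = n \<and> (\<forall>G\<in>\<G>. \<not> ord_contains H G)}"
proof (rule finite_subset)
  show "finite {..(2::nat) ^ n}" by simp
  show "{card (edges H) | H :: nat hypergraph.
      r_graph r H \<and> card (verts H) = n \<and> (\<forall>G\<in>\<G>. \<not> ord_contains H G)} \<subseteq> {..2 ^ n}"
  proof clarsimp
    fix V :: "nat set" and E
    assume "r_graph r (V, E)"
    then have "finite V" "E \<subseteq> Pow V" by (auto simp: r_graph_def)
    then show "card E \<le> 2 ^ card V" by (metis card_Pow card_mono finite_Pow_iff)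
  qed
qed

section \<open>Bounds for the extremal function\<close>

lemma star_le_ex_ord:
  assumes "n \<ge> 1" "r \<ge> 1"
  shows "(n - 1) choose (r - 1) \<le> ex_ord r n (ord_family r (simplices d r))"
proof -
  define S where "S = {s. s \<subseteq> {1..<n} \<and> card s = r - 1}"
  define H where "H = ({0..<n}, insert 0 ` S)"
  have fin: "finite s" if "s \<in> S" for s
    using that finite_subset by (auto simp: S_def)
  have "0 \<notin> s" if "s \<in> S" for s using that by (auto simp: S_def)
  then have "inj_on (insert 0) S" by (auto simp: inj_on_def dest: insert_ident)
  then have "card (edges H) = (n - 1) choose (r - 1)"
    by (simp add: H_def S_def card_image n_subsets)
  moreover have "r_graph r H"
    using assms fin by (auto simp: r_graph_def H_def S_def card_insert_if)
  moreover have "\<forall>G\<in>ord_family r (simplices d r). \<not> ord_contains H G"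
    using star_simplex_free[of H 0] by (auto simp: H_def)
  moreover have "card (verts H) = n" by (simp add: H_def)
  ultimately show ?thesis
    unfolding ex_ord_def by (intro Max_ge finite_ex_ord_set CollectI exI[of _ H]) simp
qed

lemma ex_ord_simplices_le:
  assumes "r \<ge> d + 1" "d \<ge> 1"
  shows "ex_ord r n (ord_family r (simplices d r)) \<le> r * (r * (n choose (r - 1)))"
proof -
  let ?P = "\<lambda>H :: nat hypergraph. r_graph r H \<and> card (verts H) = n \<and>
      (\<forall>G\<in>ord_family r (simplices d r). \<not> ord_contains H G)"
  \<comment> \<open>The edgeless hypergraph is vacuously a star, so the maximum is over a nonempty
    set.\<close>
  have "?P ({0..<n}, {})"
    using star_simplex_free[of "({0..<n}, {})"] by (auto simp: r_graph_def)
  then have "{card (edges H) | H. ?P H} \<noteq> {}" by blast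
  moreover have "card (edges H) \<le> r * (r * (n choose (r - 1)))" if "?P H" for H
    using simplex_free_card_le[OF assms, of H] that by blast
  ultimately show ?thesis
    unfolding ex_ord_def by (subst Max_le_iff[OF finite_ex_ord_set]) auto
qed

theorem theorem1p4:
  fixes r d :: nat
  assumes "r \<ge> d + 1" and "d + 1 \<ge> 3"
  shows "(\<lambda>n. real (ex_ord r n (ord_family r (simplices d r)))) \<in> \<Theta>(\<lambda>n. real n ^ (r - 1))"
proof (rule bigthetaI)
  let ?ex = "\<lambda>n. ex_ord r n (ord_family r (simplices d r))"
  show "(\<lambda>n. real (?ex n)) \<in> O(\<lambda>n. real n ^ (r - 1))"
  \<comment> \<open>One factor \<open>r\<close> counts the rounds, the other the gaps.\<close>
  proof (rule bigoI[of _ "real (r * r)"], rule always_eventually, rule allI)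
    fix n
    have "?ex n \<le> r * (r * (n choose (r - 1)))"
      using assms by (intro ex_ord_simplices_le) auto
    also have "n choose (r - 1) \<le> n ^ (r - 1)"
      by (cases "r - 1 \<le> n") (auto simp: binomial_le_pow binomial_eq_0)
    finally have "real (?ex n) \<le> real (r * (r * n ^ (r - 1)))"
      by (simp only: of_nat_le_iff mult_le_mono2)
    then show "norm (real (?ex n)) \<le> real (r * r) * norm (real n ^ (r - 1))"
      by (simp add: mult.assoc)
  qed
  define k where "k = r - 1"
  have k: "k \<ge> 1" using assms by (simp add: k_def)
  show "(\<lambda>n. real (?ex n)) \<in> \<Omega>(\<lambda>n. real n ^ (r - 1))"
  \<comment> \<open>For \<open>n \<ge> k + 1 \<ge> 2\<close>, \<open>n - 1\<close> is at least
    \<open>n / 2\<close>, and \<open>n - 1\<close> choose \<open>k\<close> is at least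
    \<open>((n - 1) / k) ^ k\<close>.\<close>
  proof (rule landau_omega.bigI[of "(1 / (2 * real k)) ^ k"])
    show "(1 / (2 * real k)) ^ k > 0" using k by simp
    show "\<forall>\<^sub>F n in at_top. norm (real (?ex n)) \<ge> (1 / (2 * real k)) ^ k * norm (real n ^ (r - 1))"
      using eventually_ge_at_top[of "k + 1"]
    proof eventually_elim
      case (elim n)
      have "(1 / (2 * real k)) ^ k * real n ^ k = (real n / 2 / real k) ^ k"
        by (simp add: power_mult_distrib[symmetric])
      also have "\<dots> \<le> (real (n - 1) / real k) ^ k"
        using elim k by (intro power_mono divide_right_mono) auto
      also have "\<dots> \<le> real ((n - 1) choose k)"
        using binomial_ge_n_over_k_pow_k[of k "n - 1", where 'a = real] elim by simp
      also have "\<dots> \<le> real (?ex n)"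
        using star_le_ex_ord[of n r d] elim assms by (simp add: k_def)
      finally show ?case by (simp add: k_def)
    qed
  qed
qed

end
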